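(* For every positive integer $r$ there is $n_0$ such that for all $n\ge n_0$, every $r$-degenerate bipartite graph $H$ with $n$ vertices satisfies $r(H)\le 2^{8r^{1/3}(\log_2 n)^{2/3}}n$.
   Context: A graph is $r$-degenerate if every one of its subgraphs contains a vertex of degree at most $r$. For a graph $H$, the Ramsey number $r(H)$ is the minimum positive integer $N$ such that every $2$-coloring of the edges of $K_N$ contains a monochromatic copy of $H$. Logarithms are base $2$. *)

theory Defs
  imports Complex_Main "HOL-Library.Ramsey"
begin

text \<open>
  A finite simple graph is a finite vertex set \<open>V\<close> together with a set \<open>E\<close> of two-element
  subsets of \<open>V\<close>. Accordingly, \<open>[V]\<^bsup>2\<^esup>\<close> (\<^const>\<open>nsets\<close>) is the edge set of the complete
  graph on \<open>V\<close>.
\<close>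

definition simple_graph :: "'a set \<Rightarrow> 'a set set \<Rightarrow> bool" where
  "simple_graph V E \<longleftrightarrow> finite V \<and> E \<subseteq> [V]\<^bsup>2\<^esup>"

definition subgraph :: "'a set \<Rightarrow> 'a set set \<Rightarrow> 'a set \<Rightarrow> 'a set set \<Rightarrow> bool" where
  "subgraph W F V E \<longleftrightarrow> simple_graph W F \<and> W \<subseteq> V \<and> F \<subseteq> E"

definition degree :: "'a set set \<Rightarrow> 'a \<Rightarrow> nat" where
  "degree E v = card {e \<in> E. v \<in> e}"

text \<open>The subgraph without vertices contains no vertex at all and has to be excluded.\<close>

definition degenerate :: "nat \<Rightarrow> 'a set \<Rightarrow> 'a set set \<Rightarrow> bool" where
  "degenerate r V E \<longleftrightarrow>
     (\<forall>W F. subgraph W F V E \<and> W \<noteq> {} \<longrightarrow> (\<exists>v\<in>W. degree F v \<le> r))"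

definition bipartite :: "'a set \<Rightarrow> 'a set set \<Rightarrow> bool" where
  "bipartite V E \<longleftrightarrow>
     (\<exists>A B. A \<union> B = V \<and> A \<inter> B = {} \<and> (\<forall>e\<in>E. \<exists>a\<in>A. \<exists>b\<in>B. e = {a, b}))"

text \<open>Copies are not required to be induced.\<close>

definition contains_copy :: "'b set \<Rightarrow> 'b set set \<Rightarrow> 'a set \<Rightarrow> 'a set set \<Rightarrow> bool" where
  "contains_copy V' E' V E \<longleftrightarrow>
     (\<exists>f. inj_on f V \<and> f ` V \<subseteq> V' \<and> (\<forall>e\<in>E. f ` e \<in> E'))"

text \<open>
  The complete graph on \<open>N\<close> vertices has vertex set \<open>{..<N}\<close>. A 2-coloring \<open>c\<close> of its edges is
  represented by a total function; its values outside \<open>[{..<N}]\<^bsup>2\<^esup>\<close> play no role.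
\<close>

definition ramsey_property :: "nat \<Rightarrow> 'a set \<Rightarrow> 'a set set \<Rightarrow> bool" where
  "ramsey_property N V E \<longleftrightarrow>
     (\<forall>c :: nat set \<Rightarrow> bool. \<exists>i. contains_copy {..<N} {e \<in> [{..<N}]\<^bsup>2\<^esup>. c e = i} V E)"

definition ramsey_number :: "'a set \<Rightarrow> 'a set set \<Rightarrow> nat" where
  "ramsey_number V E = (LEAST N. 0 < N \<and> ramsey_property N V E)"

text \<open>
  By Ramsey's theorem the minimum is taken over a nonempty set, so \<^const>\<open>ramsey_number\<close> is
  well-defined.
\<close>

lemma ramsey_property_mono:
  assumes "ramsey_property M V E" "M \<le> N"
  shows "ramsey_property N V E"
  unfolding ramsey_property_def
proof
  fix c :: "nat set \<Rightarrow> bool"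
  obtain i where "contains_copy {..<M} {e \<in> [{..<M}]\<^bsup>2\<^esup>. c e = i} V E"
    using assms(1) unfolding ramsey_property_def by blast
  then obtain f where f: "inj_on f V" "f ` V \<subseteq> {..<M}"
      "\<forall>e\<in>E. f ` e \<in> {e \<in> [{..<M}]\<^bsup>2\<^esup>. c e = i}"
    unfolding contains_copy_def by (elim exE conjE)
  have sub: "{..<M} \<subseteq> {..<N}"
    using assms(2) by simp
  then have "[{..<M}]\<^bsup>2\<^esup> \<subseteq> [{..<N}]\<^bsup>2\<^esup>"
    by (rule nsets_mono)
  then have "\<forall>e\<in>E. f ` e \<in> {e \<in> [{..<N}]\<^bsup>2\<^esup>. c e = i}"
    using f(3) by (simp add: subset_iff)
  moreover have "f ` V \<subseteq> {..<N}"
    using f(2) sub by (rule order_trans)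
  ultimately have "contains_copy {..<N} {e \<in> [{..<N}]\<^bsup>2\<^esup>. c e = i} V E"
    unfolding contains_copy_def using f(1) by (intro exI[of _ f] conjI)
  then show "\<exists>i. contains_copy {..<N} {e \<in> [{..<N}]\<^bsup>2\<^esup>. c e = i} V E" ..
qed

lemma ramsey_property_ex:
  assumes "simple_graph V E"
  shows "\<exists>N>0. ramsey_property N V E"
proof -
  obtain N :: nat where N: "partn_lst {..<N} [card V, card V] 2"
    using ramsey_full by blast
  have "ramsey_property N V E"
    unfolding ramsey_property_def
  proof
    fix c :: "nat set \<Rightarrow> bool"
    have "(\<lambda>e. if c e then 1 else 0) \<in> [{..<N}]\<^bsup>2\<^esup> \<rightarrow> {..<length [card V, card V]}"
      by auto
    then obtain j where j: "j < length [card V, card V]"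
        "monochromatic {..<N} ([card V, card V] ! j) 2 (\<lambda>e. if c e then 1 else (0::nat)) j"
      using N unfolding partn_lst_def by blast
    moreover from j(1) have "[card V, card V] ! j = card V"
      by (auto simp: less_Suc_eq)
    ultimately have "monochromatic {..<N} (card V) 2 (\<lambda>e. if c e then 1 else (0::nat)) j"
      by simp
    then obtain H where H: "H \<in> [{..<N}]\<^bsup>card V\<^esup>"
        "(\<lambda>e. if c e then 1 else (0::nat)) ` [H]\<^bsup>2\<^esup> \<subseteq> {j}"
      unfolding monochromatic_def by blast
    have "finite H" "H \<subseteq> {..<N}" "card H = card V"
      using H(1) by (auto simp: nsets_def)
    then obtain f where f: "bij_betw f V H"
      using assms finite_same_card_bij unfolding simple_graph_def by metis
    have "f ` e \<in> {e \<in> [{..<N}]\<^bsup>2\<^esup>. c e = (j = 1)}" if "e \<in> E" for e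
    proof -
      have e: "e \<subseteq> V" "finite e" "card e = 2"
        using that assms by (auto simp: simple_graph_def nsets_def)
      have "card (f ` e) = 2"
        using e f by (metis bij_betw_def card_image inj_on_subset)
      moreover have "f ` e \<subseteq> H"
        using e f by (auto simp: bij_betw_def)
      ultimately have "f ` e \<in> [H]\<^bsup>2\<^esup>"
        using e by (simp add: nsets_def)
      moreover from this have "(if c (f ` e) then 1 else (0::nat)) = j"
        using H(2) by blast
      ultimately show ?thesis
        using \<open>H \<subseteq> {..<N}\<close> by (auto simp: nsets_def split: if_splits)
    qed
    moreover have "inj_on f V" "f ` V \<subseteq> {..<N}"
      using f \<open>H \<subseteq> {..<N}\<close> by (auto simp: bij_betw_def)
    ultimately have "contains_copy {..<N} {e \<in> [{..<N}]\<^bsup>2\<^esup>. c e = (j = 1)} V E"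
      unfolding contains_copy_def by (intro exI[of _ f] conjI ballI)
    then show "\<exists>i. contains_copy {..<N} {e \<in> [{..<N}]\<^bsup>2\<^esup>. c e = i} V E" ..
  qed
  then have "ramsey_property (Suc N) V E"
    by (rule ramsey_property_mono) simp
  then show ?thesis by blast
qed

end

theory Submission
  imports Defs
begin

text \<open>
  The proof is dependent random choice, applied twice to the majority colour of a 2-colouring of
  \<open>K\<^sub>N\<close>. The common neighbourhood \<open>X\<close> of \<open>t\<close> random vertices is large, and with positive
  probability every \<open>(p + r)\<close>-tuple in it has at least \<open>n\<close> common neighbours. Let \<open>Y\<close> be the common
  neighbourhood of a random \<open>p\<close>-tuple in \<open>X\<close>. An \<open>r\<close>-tuple in \<open>X\<close> extended by this \<open>p\<close>-tuple still has
  \<open>n\<close> common neighbours, and all of them lie in \<open>Y\<close>; conversely, with positive probability every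
  \<open>r\<close>-tuple in \<open>Y\<close> has \<open>n\<close> common neighbours in \<open>X\<close>. Adding the vertices of \<open>H\<close> one by one, each
  with at most \<open>r\<close> earlier neighbours, then embeds \<open>H\<close> greedily with its two sides in \<open>X\<close> and \<open>Y\<close>.
\<close>

section \<open>Counting tuples by moments of degrees\<close>

text \<open>Double counting of pairs \<open>(xs, i)\<close>: for fixed \<open>i\<close> the
  admissible \<open>xs\<close> are exactly the tuples over \<open>{x \<in> A. P x i}\<close>.
  Dividing by \<open>card A ^ t\<close> turns sums of this kind into expectations over a random
  tuple, so all probabilistic steps below are plain counting.\<close>

lemma sum_card_tuples:
  assumes "finite A" "finite I"
  shows "(\<Sum>xs | set xs \<subseteq> A \<and> length xs = t. card {i \<in> I. \<forall>x\<in>set xs. P x i})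
    = (\<Sum>i\<in>I. card {x \<in> A. P x i} ^ t)"
proof -
  let ?L = "{xs. set xs \<subseteq> A \<and> length xs = t}"
  have fin: "finite ?L"
    using assms(1) by (rule finite_lists_length_eq)
  have "(\<Sum>xs\<in>?L. card {i \<in> I. \<forall>x\<in>set xs. P x i})
      = (\<Sum>xs\<in>?L. \<Sum>i\<in>I. if \<forall>x\<in>set xs. P x i then 1 else 0)"
    using assms(2) by (simp add: sum.If_cases Int_def)
  also have "\<dots> = (\<Sum>i\<in>I. \<Sum>xs\<in>?L. if \<forall>x\<in>set xs. P x i then 1 else 0)"
    by (rule sum.swap)
  also have "\<dots> = (\<Sum>i\<in>I. card {x \<in> A. P x i} ^ t)"
  proof (rule sum.cong[OF refl])
    fix i
    have "(\<Sum>xs\<in>?L. if \<forall>x\<in>set xs. P x i then 1 else 0)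
        = card {xs \<in> ?L. \<forall>x\<in>set xs. P x i}"
      using fin by (simp add: sum.If_cases Int_def)
    also have "{xs \<in> ?L. \<forall>x\<in>set xs. P x i} = {xs. set xs \<subseteq> {x \<in> A. P x i} \<and> length xs = t}"
      by auto
    also have "card \<dots> = card {x \<in> A. P x i} ^ t"
      using assms(1) by (simp add: card_lists_length_eq)
    finally show "(\<Sum>xs\<in>?L. if \<forall>x\<in>set xs. P x i then 1 else 0) = card {x \<in> A. P x i} ^ t" .
  qed
  finally show ?thesis .
qed

text \<open>Convexity of the power function in the form of Jensen's inequality, with
  \<open>a\<close> any nonnegative lower bound for the mean of \<open>d\<close>.\<close>

lemma sum_power_ge:
  fixes d :: "'a \<Rightarrow> real" and a :: real
  assumes "finite W" "\<And>v. v \<in> W \<Longrightarrow> 0 \<le> d v" "0 \<le> a" "a * card W \<le> sum d W"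
  shows "card W * a ^ t \<le> (\<Sum>v\<in>W. d v ^ t)"
proof (cases t)
  case (Suc k)
  \<comment> \<open>The graph of the power function lies above its tangent at
    \<open>a\<close>.\<close>
  have tangent: "a ^ t + real t * a ^ k * (x - a) \<le> x ^ t" if "0 \<le> x" for x :: real
    unfolding Suc using that
  proof (induction k)
    case (Suc k)
    have "a ^ Suc (Suc k) + real (Suc (Suc k)) * a ^ Suc k * (x - a)
        \<le> x * (a ^ Suc k + real (Suc k) * a ^ k * (x - a))"
    proof -
      \<comment> \<open>This square term is exactly the difference of the two sides.\<close>
      have "0 \<le> real (Suc k) * a ^ k * (x - a)\<^sup>2"
        using assms(3) by simp
      then show ?thesis
        by (simp add: algebra_simps power2_eq_square)
    qed
    also have "\<dots> \<le> x * x ^ Suc k"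
      using Suc by (intro mult_left_mono)
    finally show ?case by simp
  qed simp
  \<comment> \<open>The linear parts of the tangents add up to this quantity.\<close>
  have "0 \<le> real t * a ^ k * (sum d W - a * card W)"
    using assms by simp
  then have "card W * a ^ t \<le> (\<Sum>v\<in>W. a ^ t + real t * a ^ k * (d v - a))"
    by (simp add: sum.distrib sum_subtractf algebra_simps flip: sum_distrib_left sum_distrib_right)
  also have "\<dots> \<le> (\<Sum>v\<in>W. d v ^ t)"
    using assms(2) by (intro sum_mono tangent)
  finally show ?thesis .
qed simp

text \<open>Call \<open>ys\<close> bad if it has fewer than \<open>n\<close> common neighbours in
  \<open>A\<close>. A bad \<open>ys\<close> is joined to all of \<open>xs\<close> only if
  \<open>xs\<close> is drawn from these common neighbours, which leaves at most \<open>n ^ t\<close>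
  choices; there are at most \<open>card B ^ q\<close> bad tuples.\<close>

lemma sum_bad_tuples_le:
  assumes "finite A" "finite B"
  shows "(\<Sum>xs | set xs \<subseteq> A \<and> length xs = t.
      card {ys. set ys \<subseteq> B \<and> length ys = q \<and> card {x \<in> A. \<forall>y\<in>set ys. adj x y} < n
        \<and> (\<forall>x\<in>set xs. \<forall>y\<in>set ys. adj x y)}) \<le> card B ^ q * n ^ t"
proof -
  define I where "I = {ys. set ys \<subseteq> B \<and> length ys = q \<and> card {x \<in> A. \<forall>y\<in>set ys. adj x y} < n}"
  have sub: "I \<subseteq> {ys. set ys \<subseteq> B \<and> length ys = q}"
    unfolding I_def by auto
  have fin: "finite I"
    using sub finite_lists_length_eq[OF assms(2)] by (rule finite_subset)
  have "card I \<le> card B ^ q"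
    using card_mono[OF finite_lists_length_eq[OF assms(2)] sub] assms(2)
    by (simp add: card_lists_length_eq)
  have "(\<Sum>xs | set xs \<subseteq> A \<and> length xs = t. card {ys \<in> I. \<forall>x\<in>set xs. \<forall>y\<in>set ys. adj x y})
      = (\<Sum>ys\<in>I. card {x \<in> A. \<forall>y\<in>set ys. adj x y} ^ t)"
    using assms(1) fin by (rule sum_card_tuples)
  also have "\<dots> \<le> (\<Sum>ys\<in>I. n ^ t)"
    by (intro sum_mono power_mono) (auto simp: I_def)
  also have "\<dots> \<le> card B ^ q * n ^ t"
    using \<open>card I \<le> card B ^ q\<close> by simp
  finally show ?thesis
    by (simp add: I_def conj_assoc)
qed

section \<open>Dependent random choice\<close>

text \<open>Over random \<open>xs\<close>, the common neighbourhood has mean size at least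
  \<open>\<epsilon> ^ t * card W\<close> by convexity, while \<open>few\<close> bounds the mean
  number of bad \<open>q\<close>-tuples inside it by \<open>\<epsilon> ^ t / 2\<close>. Averaging
  size minus \<open>card W\<close> times the number of bad tuples yields a suitable
  \<open>xs\<close>.\<close>

lemma dependent_random_choice:
  fixes \<epsilon> :: real
  assumes W: "finite W" "W \<noteq> {}" and "0 < \<epsilon>"
    and edges: "\<epsilon> * real (card W) ^ 2 \<le> (\<Sum>v\<in>W. card {x \<in> W. adj x v})"
    and few: "2 * (real (card W) ^ q * real n ^ t) \<le> (\<epsilon> * card W) ^ t"
  obtains U where "U \<subseteq> W" "\<epsilon> ^ t * card W / 2 \<le> card U"
    "\<And>ys. set ys \<subseteq> U \<Longrightarrow> length ys = q \<Longrightarrow> n \<le> card {x \<in> W. \<forall>y\<in>set ys. adj x y}"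
proof -
  define L where "L = {xs. set xs \<subseteq> W \<and> length xs = t}"
  define X where "X xs = {v \<in> W. \<forall>x\<in>set xs. adj x v}" for xs
  define Y where "Y xs = {ys. set ys \<subseteq> W \<and> length ys = q
      \<and> card {x \<in> W. \<forall>y\<in>set ys. adj x y} < n \<and> (\<forall>x\<in>set xs. \<forall>y\<in>set ys. adj x y)}" for xs
  let ?N = "real (card W)"
  have L: "finite L" "card L = card W ^ t"
    unfolding L_def using W(1) by (simp_all add: finite_lists_length_eq card_lists_length_eq)
  have "?N > 0"
    using W by (simp add: card_gt_0_iff)
  have "?N * (\<epsilon> * ?N) ^ t \<le> (\<Sum>v\<in>W. real (card {x \<in> W. adj x v}) ^ t)"
    using assms by (intro sum_power_ge) (auto simp: power2_eq_square mult_ac)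
  also have "\<dots> = (\<Sum>xs\<in>L. real (card (X xs)))"
    unfolding L_def X_def using sum_card_tuples[OF W(1) W(1), of adj t, symmetric]
    by (simp flip: of_nat_power of_nat_sum)
  finally have X: "?N * (\<epsilon> * ?N) ^ t \<le> (\<Sum>xs\<in>L. real (card (X xs)))" .
  have "(\<Sum>xs\<in>L. real (card (Y xs))) = real (\<Sum>xs\<in>L. card (Y xs))"
    by simp
  also have "\<dots> \<le> real (card W ^ q * n ^ t)"
    unfolding L_def Y_def using sum_bad_tuples_le[OF W(1) W(1)] by (simp only: of_nat_le_iff)
  also have "\<dots> \<le> (\<epsilon> * ?N) ^ t / 2"
    using few by simp
  \<comment> \<open>The penalty \<open>?N\<close> per bad tuple is as large as \<open>X xs\<close>
    can possibly be, so a positive balance excludes bad tuples altogether and no vertices have to be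
    deleted.\<close>
  finally have "?N * (\<Sum>xs\<in>L. real (card (Y xs))) \<le> ?N * ((\<epsilon> * ?N) ^ t / 2)"
    by (intro mult_left_mono) auto
  then have "card L * (\<epsilon> ^ t * ?N / 2) \<le> (\<Sum>xs\<in>L. card (X xs) - ?N * card (Y xs))"
    using X L by (simp add: sum_subtractf power_mult_distrib mult_ac flip: sum_distrib_left)
  moreover have "L \<noteq> {}"
    using L \<open>?N > 0\<close> by auto
  ultimately have "\<exists>xs\<in>L. \<epsilon> ^ t * ?N / 2 \<le> card (X xs) - ?N * card (Y xs)"
    using sum_strict_mono[OF L(1), of "\<lambda>xs. card (X xs) - ?N * card (Y xs)" "\<lambda>_. \<epsilon> ^ t * ?N / 2"]
    by (force simp: not_le)
  then obtain xs where "xs \<in> L" and xs: "\<epsilon> ^ t * ?N / 2 \<le> card (X xs) - ?N * card (Y xs)"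
    by blast
  have "card (X xs) \<le> card W"
    unfolding X_def using W(1) by (intro card_mono) auto
  moreover have "0 < \<epsilon> ^ t * ?N / 2"
    using \<open>0 < \<epsilon>\<close> \<open>?N > 0\<close> by simp
  ultimately have "?N * card (Y xs) < ?N * 1"
    using xs by linarith
  then have "card (Y xs) = 0"
    using \<open>?N > 0\<close> by simp
  moreover have "finite (Y xs)"
    unfolding Y_def by (rule finite_subset[OF _ finite_lists_length_eq[OF W(1), of q]]) auto
  ultimately have "Y xs = {}"
    by simp
  show thesis
  proof
    show "X xs \<subseteq> W"
      unfolding X_def by auto
    show "\<epsilon> ^ t * card W / 2 \<le> card (X xs)"
      using xs \<open>card (Y xs) = 0\<close> by simp
    show "n \<le> card {x \<in> W. \<forall>y\<in>set ys. adj x y}" if "set ys \<subseteq> X xs" "length ys = q" for ys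
    proof (rule ccontr)
      assume "\<not> ?thesis"
      with that have "ys \<in> Y xs"
        unfolding X_def Y_def by auto
      with \<open>Y xs = {}\<close> show False by simp
    qed
  qed
qed

text \<open>The \<open>p\<close>-tuples from \<open>U\<close> outnumber the pairs of a
  \<open>p\<close>-tuple and a bad \<open>r\<close>-tuple in its common neighbourhood, so some
  \<open>p\<close>-tuple occurs in no such pair.\<close>

lemma tuple_with_good_neighbourhood:
  assumes "finite U" "finite W" "card W ^ r * n ^ p < card U ^ p"
  obtains xs where "set xs \<subseteq> U" "length xs = p"
    "\<And>ys. set ys \<subseteq> {v \<in> W. \<forall>x\<in>set xs. adj x v} \<Longrightarrow> length ys = r \<Longrightarrow>
      n \<le> card {x \<in> U. \<forall>y\<in>set ys. adj x y}"
proof -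
  define L where "L = {xs. set xs \<subseteq> U \<and> length xs = p}"
  define Y where "Y xs = {ys. set ys \<subseteq> W \<and> length ys = r
      \<and> card {x \<in> U. \<forall>y\<in>set ys. adj x y} < n \<and> (\<forall>x\<in>set xs. \<forall>y\<in>set ys. adj x y)}" for xs
  have L: "finite L" "card L = card U ^ p"
    unfolding L_def using assms(1) by (simp_all add: finite_lists_length_eq card_lists_length_eq)
  have "(\<Sum>xs\<in>L. card (Y xs)) < card L * 1"
    using le_less_trans[OF sum_bad_tuples_le[OF assms(1,2)] assms(3), of adj]
    unfolding L(2) unfolding L_def Y_def by simp
  then obtain xs where "xs \<in> L" "card (Y xs) < 1"
    using sum_bounded_below[of L 1 "\<lambda>xs. card (Y xs)"] by (auto simp: not_le[symmetric])
  moreover have "finite (Y xs)"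
    unfolding Y_def by (rule finite_subset[OF _ finite_lists_length_eq[OF assms(2), of r]]) auto
  ultimately have "Y xs = {}"
    by simp
  show thesis
  proof
    show "set xs \<subseteq> U" "length xs = p"
      using \<open>xs \<in> L\<close> unfolding L_def by auto
    show "n \<le> card {x \<in> U. \<forall>y\<in>set ys. adj x y}"
      if "set ys \<subseteq> {v \<in> W. \<forall>x\<in>set xs. adj x v}" "length ys = r" for ys
    proof (rule ccontr)
      assume "\<not> ?thesis"
      with that have "ys \<in> Y xs"
        unfolding Y_def by auto
      with \<open>Y xs = {}\<close> show False by simp
    qed
  qed
qed

text \<open>Passes from sets of at most \<open>r\<close> vertices, which the embedding meets, to
  tuples of length exactly \<open>r\<close>, which the counting treats, by padding with repeated
  entries.\<close>

lemma tuple_covering_set: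
  assumes "finite S" "S \<subseteq> U" "card S \<le> r" "U \<noteq> {}"
  obtains ys where "set ys \<subseteq> U" "length ys = r" "S \<subseteq> set ys"
proof -
  obtain u where "u \<in> U"
    using assms(4) by auto
  obtain zs where zs: "set zs = S" "distinct zs"
    using finite_distinct_list[OF assms(1)] by auto
  then have "length zs \<le> r"
    using assms(3) distinct_card by fastforce
  show thesis
    by (rule that[of "zs @ replicate (r - length zs) u"])
      (use zs \<open>u \<in> U\<close> assms(2) \<open>length zs \<le> r\<close> in \<open>auto simp: in_set_replicate\<close>)
qed

text \<open>
  \<open>X\<close> and \<open>Y\<close> may overlap. This is harmless, because the greedy embedding avoids all vertices
  used before, and it spares the passage to a bipartite subgraph of the host graph.
\<close>

lemma ex_pair_with_common_neighbours:
  fixes \<epsilon> :: real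
  assumes W: "finite W" "W \<noteq> {}" and "0 < \<epsilon>" "0 < n"
    and sym: "\<And>x y. adj x y \<Longrightarrow> adj y x"
    and edges: "\<epsilon> * real (card W) ^ 2 \<le> (\<Sum>v\<in>W. card {x \<in> W. adj x v})"
    and few1: "2 * (real (card W) ^ (p + r) * real n ^ t) \<le> (\<epsilon> * card W) ^ t"
    and few2: "real (card W) ^ r * real n ^ p < (\<epsilon> ^ t * card W / 2) ^ p"
  obtains X Y where "X \<subseteq> W" "Y \<subseteq> W"
    "\<And>S. finite S \<Longrightarrow> S \<subseteq> X \<Longrightarrow> card S \<le> r \<Longrightarrow> n \<le> card {z \<in> Y. \<forall>y\<in>S. adj z y}"
    "\<And>S. finite S \<Longrightarrow> S \<subseteq> Y \<Longrightarrow> card S \<le> r \<Longrightarrow> n \<le> card {z \<in> X. \<forall>y\<in>S. adj z y}"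
proof -
  obtain X where X: "X \<subseteq> W" "\<epsilon> ^ t * card W / 2 \<le> card X"
    "\<And>ys. set ys \<subseteq> X \<Longrightarrow> length ys = p + r \<Longrightarrow> n \<le> card {x \<in> W. \<forall>y\<in>set ys. adj x y}"
    using dependent_random_choice[OF W \<open>0 < \<epsilon>\<close> edges few1] by blast
  have "finite X"
    using X(1) W(1) by (rule finite_subset)
  have "0 < card W"
    using W by (simp add: card_gt_0_iff)
  then have pos: "0 < \<epsilon> ^ t * card W / 2"
    using \<open>0 < \<epsilon>\<close> by simp
  then have "0 < real (card X)"
    using X(2) by linarith
  then have "X \<noteq> {}"
    by auto
  have "real (card W ^ r * n ^ p) < real (card X ^ p)"
    using few2 power_mono[OF X(2), of p] pos by (simp add: less_le_trans)
  then have "card W ^ r * n ^ p < card X ^ p"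
    by (simp only: of_nat_less_iff)
  then obtain xs where xs: "set xs \<subseteq> X" "length xs = p"
    "\<And>ys. set ys \<subseteq> {v \<in> W. \<forall>x\<in>set xs. adj x v} \<Longrightarrow> length ys = r \<Longrightarrow>
      n \<le> card {x \<in> X. \<forall>y\<in>set ys. adj x y}"
    using tuple_with_good_neighbourhood[OF \<open>finite X\<close> W(1)] by blast
  define Y where "Y = {v \<in> W. \<forall>x\<in>set xs. adj x v}"
  have YX: "n \<le> card {z \<in> Y. \<forall>y\<in>set ys. adj z y}" if "set ys \<subseteq> X" "length ys = r" for ys
  proof -
    have "{x \<in> W. \<forall>y\<in>set (xs @ ys). adj x y} = {z \<in> Y. \<forall>y\<in>set ys. adj z y}"
      unfolding Y_def using sym by auto
    then show ?thesis
      using X(3)[of "xs @ ys"] xs that by simp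
  qed
  have fin: "finite Y"
    unfolding Y_def using W(1) by simp
  obtain u where "u \<in> X"
    using \<open>X \<noteq> {}\<close> by auto
  \<comment> \<open>A constant tuple already has \<open>n > 0\<close> common neighbours in
    \<open>Y\<close>; padding sets in \<open>Y\<close> requires \<open>Y\<close> to be
    nonempty.\<close>
  then have "n \<le> card {z \<in> Y. \<forall>y\<in>set (replicate r u). adj z y}"
    by (intro YX) (auto simp: in_set_replicate)
  then have "Y \<noteq> {}"
    using \<open>0 < n\<close> by auto
  show thesis
  proof
    show "X \<subseteq> W" "Y \<subseteq> W"
      using X(1) by (auto simp: Y_def)
  next
    fix S
    assume "finite S" "S \<subseteq> X" "card S \<le> r"
    then obtain ys where ys: "set ys \<subseteq> X" "length ys = r" "S \<subseteq> set ys"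
      using \<open>X \<noteq> {}\<close> by (rule tuple_covering_set)
    have "n \<le> card {z \<in> Y. \<forall>y\<in>set ys. adj z y}"
      using ys by (intro YX)
    also have "\<dots> \<le> card {z \<in> Y. \<forall>y\<in>S. adj z y}"
      using ys(3) fin by (intro card_mono) auto
    finally show "n \<le> card {z \<in> Y. \<forall>y\<in>S. adj z y}" .
  next
    fix S
    assume "finite S" "S \<subseteq> Y" "card S \<le> r"
    then obtain ys where ys: "set ys \<subseteq> Y" "length ys = r" "S \<subseteq> set ys"
      using \<open>Y \<noteq> {}\<close> by (rule tuple_covering_set)
    have "n \<le> card {z \<in> X. \<forall>y\<in>set ys. adj z y}"
      using ys xs(3) unfolding Y_def by simp
    also have "\<dots> \<le> card {z \<in> X. \<forall>y\<in>S. adj z y}"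
      using ys(3) \<open>finite X\<close> by (intro card_mono) auto
    finally show "n \<le> card {z \<in> X. \<forall>y\<in>S. adj z y}" .
  qed
qed

section \<open>Greedy embedding\<close>

text \<open>Induction on \<open>W\<close>: degeneracy yields a vertex \<open>v\<close> of degree at
  most \<open>r\<close> in the subgraph induced on \<open>W\<close>; the rest is embedded first and
  \<open>v\<close> last. This produces the degenerate ordering implicitly.\<close>

lemma degenerate_bipartite_embedding:
  fixes adj :: "'b \<Rightarrow> 'b \<Rightarrow> bool"
  assumes "simple_graph V E" "degenerate r V E"
    and AB: "A \<union> B = V" "A \<inter> B = {}" "\<forall>e\<in>E. \<exists>a\<in>A. \<exists>b\<in>B. e = {a, b}"
    and sym: "\<And>x y. adj x y \<Longrightarrow> adj y x"
    and X: "\<And>S. finite S \<Longrightarrow> S \<subseteq> X \<Longrightarrow> card S \<le> r \<Longrightarrow> card V \<le> card {z \<in> Y. \<forall>y\<in>S. adj z y}"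
    and Y: "\<And>S. finite S \<Longrightarrow> S \<subseteq> Y \<Longrightarrow> card S \<le> r \<Longrightarrow> card V \<le> card {z \<in> X. \<forall>y\<in>S. adj z y}"
    and "W \<subseteq> V"
  shows "\<exists>f. inj_on f W \<and> f ` (W \<inter> A) \<subseteq> X \<and> f ` (W \<inter> B) \<subseteq> Y
    \<and> (\<forall>x\<in>W. \<forall>y\<in>W. {x, y} \<in> E \<longrightarrow> adj (f x) (f y))"
proof -
  have "finite W"
    using assms(1) \<open>W \<subseteq> V\<close> finite_subset unfolding simple_graph_def by auto
  then show ?thesis
    using \<open>W \<subseteq> V\<close>
  proof (induction W rule: finite_psubset_induct)
    case (psubset W)
    show ?case
    proof (cases "W = {}")
      case False
      define F where "F = {e \<in> E. e \<subseteq> W}"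
      have "subgraph W F V E"
        using assms(1) psubset unfolding subgraph_def simple_graph_def F_def nsets_def by auto
      then obtain v where v: "v \<in> W" "degree F v \<le> r"
        using assms(2) False unfolding degenerate_def by blast
      obtain f where f: "inj_on f (W - {v})" "f ` ((W - {v}) \<inter> A) \<subseteq> X" "f ` ((W - {v}) \<inter> B) \<subseteq> Y"
        "\<forall>x\<in>W - {v}. \<forall>y\<in>W - {v}. {x, y} \<in> E \<longrightarrow> adj (f x) (f y)"
      proof -
        have "W - {v} \<subset> W" "W - {v} \<subseteq> V"
          using v(1) psubset.prems by auto
        from psubset.IH[OF this] show thesis
          by (elim exE conjE) (rule that)
      qed
      define S where "S = {w \<in> W. {v, w} \<in> E}"
      have not_loop: "{x, x} \<notin> E" for x
        using assms(1) unfolding simple_graph_def nsets_def by auto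
      have "finite F"
        using psubset.hyps unfolding F_def by (auto intro: finite_subset[of _ "Pow W"])
      then have "card S \<le> card {e \<in> F. v \<in> e}"
        using v(1) by (intro card_inj_on_le[of "\<lambda>w. {v, w}"] finite_subset[OF _ \<open>finite F\<close>])
          (auto simp: inj_on_def doubleton_eq_iff F_def S_def)
      then have "card S \<le> r"
        using v(2) unfolding degree_def by simp
      have S: "finite S" "S \<subseteq> W - {v}"
        using psubset.hyps not_loop[of v] unfolding S_def by auto
      have fS: "finite (f ` S)" "card (f ` S) \<le> r"
        using S \<open>card S \<le> r\<close> card_image_le[OF S(1), of f] by auto
      \<comment> \<open>Fewer than \<open>card V\<close> vertices are occupied so far, so among
        \<open>card V\<close> candidates one is free.\<close>
      have *: "\<exists>z\<in>Z. z \<notin> f ` (W - {v}) \<and> (\<forall>y\<in>f ` S. adj z y)"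
        if "card V \<le> card {z \<in> Z. \<forall>y\<in>f ` S. adj z y}" for Z
      proof -
        have "card (f ` (W - {v})) \<le> card (W - {v})"
          using psubset.hyps by (intro card_image_le) auto
        also have "\<dots> < card W"
          using psubset.hyps v(1) by (intro psubset_card_mono) auto
        also have "\<dots> \<le> card V"
          using psubset.prems assms(1) by (intro card_mono) (auto simp: simple_graph_def)
        finally have "card (f ` (W - {v})) < card {z \<in> Z. \<forall>y\<in>f ` S. adj z y}"
          using that by simp
        moreover have "finite (f ` (W - {v}))"
          using psubset.hyps by simp
        ultimately have "\<not> {z \<in> Z. \<forall>y\<in>f ` S. adj z y} \<subseteq> f ` (W - {v})"
          using card_mono leD by blast
        then show ?thesis by auto
      qed
      \<comment> \<open>All neighbours of \<open>v\<close> lie on the other side, so their images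
        lie in only one of \<open>X\<close> and \<open>Y\<close>, and the hypothesis on that set
        supplies candidates in the other.\<close>
      have opposite: "(v \<in> A \<longrightarrow> w \<in> B) \<and> (v \<in> B \<longrightarrow> w \<in> A)" if "w \<in> S" for w
      proof -
        obtain a b where "a \<in> A" "b \<in> B" "{v, w} = {a, b}"
          using AB(3) \<open>w \<in> S\<close> unfolding S_def by blast
        then show ?thesis
          using AB(2) by (auto simp: doubleton_eq_iff)
      qed
      obtain z where z: "v \<in> A \<Longrightarrow> z \<in> X" "v \<in> B \<Longrightarrow> z \<in> Y" "z \<notin> f ` (W - {v})"
        "\<And>w. w \<in> S \<Longrightarrow> adj z (f w)"
      proof (cases "v \<in> A")
        case True
        then have "S \<subseteq> B"
          using opposite by auto
        then have "f ` S \<subseteq> Y"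
          using f(3) S(2) by auto
        from *[OF Y[OF fS(1) this fS(2)]] show thesis
          using that True AB(2) by blast
      next
        case False
        then have "v \<in> B"
          using v(1) psubset.prems AB(1) by auto
        then have "S \<subseteq> A"
          using opposite by auto
        then have "f ` S \<subseteq> X"
          using f(2) S(2) by auto
        from *[OF X[OF fS(1) this fS(2)]] show thesis
          using that False by blast
      qed
      let ?g = "f(v := z)"
      have "inj_on ?g W"
        using f(1) z(3) by (auto simp: inj_on_def)
      moreover have "?g ` (W \<inter> A) \<subseteq> X" "?g ` (W \<inter> B) \<subseteq> Y"
        using f(2,3) z(1,2) by auto
      moreover have "adj (?g x) (?g y)" if "x \<in> W" "y \<in> W" "{x, y} \<in> E" for x y
      proof -
        consider "x = v" "y = v" | "x = v" "y \<noteq> v" | "x \<noteq> v" "y = v" | "x \<noteq> v" "y \<noteq> v"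
          by blast
        then show ?thesis
        proof cases
          case 1
          with that not_loop[of v] show ?thesis by simp
        next
          case 2
          with that z(4)[of y] show ?thesis by (simp add: S_def)
        next
          case 3
          with that z(4)[of x] sym show ?thesis by (simp add: S_def insert_commute)
        next
          case 4
          with that f(4) show ?thesis by simp
        qed
      qed
      ultimately show ?thesis
        by (intro exI[of _ ?g] conjI ballI impI)
    qed simp
  qed
qed

section \<open>Monochromatic copies in a 2-colouring\<close>

text \<open>One factor 1/2 is for the more frequent colour; the other absorbs the missing diagonal,
  as \<open>N * (N - 1)\<close> is at least half of \<open>N ^ 2\<close>.\<close>

lemma majority_colour:
  fixes c :: "nat set \<Rightarrow> bool"
  assumes "2 \<le> N"
  obtains i where "1/4 * real N ^ 2 \<le> (\<Sum>v<N. card {x \<in> {..<N}. x \<noteq> v \<and> c {x, v} = i})"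
proof -
  define s where "s i = (\<Sum>v<N. card {x \<in> {..<N}. x \<noteq> v \<and> c {x, v} = i})" for i
  have "card {x \<in> {..<N}. x \<noteq> v \<and> c {x, v} = True} + card {x \<in> {..<N}. x \<noteq> v \<and> c {x, v} = False}
      = N - 1" if "v < N" for v
  proof -
    have "card {x \<in> {..<N}. x \<noteq> v \<and> c {x, v} = True} + card {x \<in> {..<N}. x \<noteq> v \<and> c {x, v} = False}
        = card ({..<N} - {v})"
      by (subst card_Un_disjoint[symmetric]) (auto intro!: arg_cong[where f = card])
    then show ?thesis
      using that by simp
  qed
  then have "s True + s False = N * (N - 1)"
    unfolding s_def by (simp flip: sum.distrib)
  then have "real (s True) + real (s False) = real N * (real N - 1)"
    using assms by (simp add: of_nat_diff flip: of_nat_add)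
  moreover have "real N * (real N / 2) \<le> real N * (real N - 1)"
    using assms by (intro mult_left_mono) auto
  ultimately have "1/4 * real N ^ 2 \<le> s True \<or> 1/4 * real N ^ 2 \<le> s False"
    by (auto simp: power2_eq_square)
  then show thesis
    using that unfolding s_def by blast
qed

text \<open>The two random choices run in the majority colour with \<open>\<epsilon> = 1/4\<close>
  and \<open>n = card V\<close>; \<open>few1\<close> and \<open>few2\<close> are their respective
  counting conditions.\<close>

lemma ramsey_property_degenerate_bipartite:
  assumes H: "simple_graph V E" "bipartite V E" "degenerate r V E" and "0 < card V" "2 \<le> N"
    and few1: "2 * (real N ^ (p + r) * real (card V) ^ t) \<le> (real N / 4) ^ t"
    and few2: "real N ^ r * real (card V) ^ p < (real N / (2 * 4 ^ t)) ^ p"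
  shows "ramsey_property N V E"
  unfolding ramsey_property_def
proof
  fix c :: "nat set \<Rightarrow> bool"
  obtain i where i: "1/4 * real N ^ 2 \<le> (\<Sum>v<N. card {x \<in> {..<N}. x \<noteq> v \<and> c {x, v} = i})"
    using majority_colour[OF \<open>2 \<le> N\<close>] .
  \<comment> \<open>Loops are excluded by hand because \<open>c\<close> also takes a value on the
    singleton \<open>{x}\<close>.\<close>
  define adj where "adj x y \<longleftrightarrow> x \<noteq> y \<and> c {x, y} = i" for x y
  have sym: "adj x y \<Longrightarrow> adj y x" for x y
    by (simp add: adj_def insert_commute)
  obtain X Y where XY: "X \<subseteq> {..<N}" "Y \<subseteq> {..<N}"
    "\<And>S. finite S \<Longrightarrow> S \<subseteq> X \<Longrightarrow> card S \<le> r \<Longrightarrow> card V \<le> card {z \<in> Y. \<forall>y\<in>S. adj z y}"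
    "\<And>S. finite S \<Longrightarrow> S \<subseteq> Y \<Longrightarrow> card S \<le> r \<Longrightarrow> card V \<le> card {z \<in> X. \<forall>y\<in>S. adj z y}"
  proof (rule ex_pair_with_common_neighbours[of "{..<N}" "1/4" "card V" adj p r t])
    show "{..<N} \<noteq> {}"
      using \<open>2 \<le> N\<close> by (auto simp: lessThan_empty_iff)
    show "1/4 * real (card {..<N}) ^ 2 \<le> (\<Sum>v<N. card {x \<in> {..<N}. adj x v})"
      using i unfolding adj_def by simp
    show "2 * (real (card {..<N}) ^ (p + r) * real (card V) ^ t) \<le> (1/4 * card {..<N}) ^ t"
      using few1 by simp
    show "real (card {..<N}) ^ r * real (card V) ^ p < ((1/4) ^ t * card {..<N} / 2) ^ p"
      using few2 by (simp add: power_one_over field_simps)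
  qed (use sym \<open>0 < card V\<close> in auto)
  obtain A B where AB: "A \<union> B = V" "A \<inter> B = {}" "\<forall>e\<in>E. \<exists>a\<in>A. \<exists>b\<in>B. e = {a, b}"
    using H(2) unfolding bipartite_def by auto
  obtain f where f: "inj_on f V" "f ` (V \<inter> A) \<subseteq> X" "f ` (V \<inter> B) \<subseteq> Y"
    "\<forall>x\<in>V. \<forall>y\<in>V. {x, y} \<in> E \<longrightarrow> adj (f x) (f y)"
  proof -
    have "\<exists>f. inj_on f V \<and> f ` (V \<inter> A) \<subseteq> X \<and> f ` (V \<inter> B) \<subseteq> Y
        \<and> (\<forall>x\<in>V. \<forall>y\<in>V. {x, y} \<in> E \<longrightarrow> adj (f x) (f y))"
    proof (rule degenerate_bipartite_embedding[OF H(1,3) AB])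
      show "adj x y \<Longrightarrow> adj y x" for x y
        by (rule sym)
    qed (use XY(3,4) in auto)
    then show thesis
      by (elim exE conjE) (rule that)
  qed
  have "f ` V \<subseteq> {..<N}"
    using f(2,3) XY(1,2) AB(1) by fast
  moreover have "f ` e \<in> {e \<in> [{..<N}]\<^bsup>2\<^esup>. c e = i}" if "e \<in> E" for e
  proof -
    obtain a b where ab: "a \<in> A" "b \<in> B" "e = {a, b}"
      using AB(3) \<open>e \<in> E\<close> by blast
    then have "a \<in> V" "b \<in> V"
      using AB(1) by auto
    then have "f a < N" "f b < N"
      using \<open>f ` V \<subseteq> {..<N}\<close> by auto
    moreover have "f a \<noteq> f b" "c {f a, f b} = i"
      using f(4) \<open>a \<in> V\<close> \<open>b \<in> V\<close> ab(3) that by (auto simp: adj_def)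
    ultimately show ?thesis
      using ab(3) by (simp add: nsets_def)
  qed
  ultimately show "\<exists>i. contains_copy {..<N} {e \<in> [{..<N}]\<^bsup>2\<^esup>. c e = i} V E"
    unfolding contains_copy_def using f(1)
    by (intro exI[of _ i] exI[of _ f] conjI ballI)
qed

section \<open>Choice of parameters\<close>

text \<open>
  Here \<open>y = (log n / r)\<^bsup>1/3\<^esup>\<close> and \<open>l = log N\<close>, so that \<open>log n = r y\<^sup>3\<close>; the two
  conclusions are the logarithms of the counting conditions above.
\<close>

lemma parameters_exist:
  fixes y l :: real and r :: nat
  assumes "1 \<le> r" "4 \<le> y"
    and l: "r * y ^ 3 + 8 * real r * y\<^sup>2 - 1 \<le> l" "l \<le> r * y ^ 3 + 8 * real r * y\<^sup>2"
  obtains p t :: nat where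
    "1 + real (p + r) * l \<le> real t * (l - r * y ^ 3 - 2)"
    "real r * l < real p * (l - r * y ^ 3 - 2 * real t - 1)"
proof
  \<comment> \<open>Up to lower-order terms \<open>l\<close> is \<open>r * y ^ 3\<close> and the
    excess \<open>l - r * y ^ 3\<close> is \<open>8 * w\<close>. The first condition then compares
    \<open>w * w\<close> with \<open>8 * w * w\<close>, the second \<open>r * y * w\<close> with
    \<open>r * y * (6 * w)\<close>; the slack pays for rounding and for the lower-order
    terms.\<close>
  define p where "p = nat \<lceil>r * y\<rceil>"
  define t where "t = nat \<lceil>r * y\<^sup>2\<rceil>"
  define w where "w = r * y\<^sup>2"
  have "4 * y \<le> y\<^sup>2"
    using assms(2) by (simp add: power2_eq_square mult_right_mono)
  have r: "1 \<le> real r"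
    using assms(1) by simp
  have "16 \<le> w"
    unfolding w_def using mult_mono[of 1 "real r" 16 "y\<^sup>2"] r \<open>4 * y \<le> y\<^sup>2\<close> assms(2) by simp
  have "0 \<le> r * y"
    using assms by simp
  then have p: "r * y \<le> p" "p \<le> r * y + 1"
    unfolding p_def by linarith+
  have t: "w \<le> t" "t \<le> w + 1"
    unfolding t_def w_def[symmetric] using \<open>16 \<le> w\<close> by linarith+
  have l: "8 * w - 1 \<le> l - r * y ^ 3" "l \<le> w * (y + 8)"
    using l by (simp_all add: w_def algebra_simps power3_eq_cube power2_eq_square)
  have "0 \<le> l"
    using l(1) \<open>16 \<le> w\<close> assms(2) zero_le_power[of y 3] mult_nonneg_nonneg[of r "y ^ 3"] by linarith
  have "real (p + r) * l \<le> (r * (y + 2)) * (w * (y + 8))"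
    using p r l(2) \<open>0 \<le> l\<close> assms(2) by (intro mult_mono) (auto simp: algebra_simps)
  also have "\<dots> = r * w * ((y + 2) * (y + 8))"
    by simp
  \<comment> \<open>Both factors use \<open>4 \<le> y\<close>.\<close>
  also have "\<dots> \<le> r * w * ((3/2 * y) * (3 * y))"
    using \<open>16 \<le> w\<close> assms(2) by (intro mult_left_mono mult_mono) auto
  also have "\<dots> = 9/2 * (w * w)"
    by (simp add: w_def power2_eq_square)
  also have "\<dots> + 1 \<le> w * (8 * w - 3)"
    proof -
    have "16 * w \<le> w * w"
      using \<open>16 \<le> w\<close> by simp
    then show ?thesis
      using \<open>16 \<le> w\<close> unfolding right_diff_distrib by linarith
  qed
  also have "\<dots> \<le> t * (l - r * y ^ 3 - 2)"
    using t l(1) \<open>16 \<le> w\<close> by (intro mult_mono) auto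
  finally show "1 + real (p + r) * l \<le> real t * (l - r * y ^ 3 - 2)"
    by simp
  have "r * l \<le> r * (w * (y + 8))"
    using l(2) by (intro mult_left_mono) auto
  also have "\<dots> = r * y * w + 2 * r * (4 * y) * (r * y)"
    by (simp add: w_def algebra_simps power2_eq_square)
  also have "\<dots> \<le> r * y * w + 2 * r * y\<^sup>2 * (r * y)"
    using \<open>4 * y \<le> y\<^sup>2\<close> \<open>0 \<le> r * y\<close> by (intro add_left_mono mult_right_mono mult_left_mono) auto
  also have "\<dots> = r * y * (3 * w)"
    by (simp add: w_def algebra_simps)
  \<comment> \<open>The value \<open>6 * w - 4\<close> is
    \<open>(8 * w - 1) - 2 * (w + 1) - 1\<close>, with the rounding of \<open>l\<close> and of
    \<open>t\<close> taken into account.\<close>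
  also have "\<dots> < r * y * (6 * w - 4)"
    using \<open>16 \<le> w\<close> r assms(2) by (intro mult_strict_left_mono) auto
  also have "\<dots> \<le> p * (l - r * y ^ 3 - 2 * real t - 1)"
    using p t l(1) \<open>16 \<le> w\<close> by (intro mult_mono) auto
  finally show "real r * l < real p * (l - r * y ^ 3 - 2 * real t - 1)" .
qed

section \<open>The bound on the Ramsey number\<close>

text \<open>With \<open>N\<close> the rounded-down target bound, exponentiating the two inequalities
  from \<open>parameters_exist\<close> gives the two counting conditions.\<close>

lemma ramsey_property_powr:
  fixes y :: real
  assumes H: "simple_graph V E" "bipartite V E" "degenerate r V E"
    and "1 \<le> r" "4 \<le> y" and V: "real (card V) = 2 powr (r * y ^ 3)"
  shows "ramsey_property (nat \<lfloor>2 powr (8 * real r * y\<^sup>2) * card V\<rfloor>) V E"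
proof -
  define n where "n = real (card V)"
  define u where "u = 2 powr (r * y ^ 3 + 8 * real r * y\<^sup>2)"
  define N where "N = nat \<lfloor>2 powr (8 * real r * y\<^sup>2) * card V\<rfloor>"
  define l where "l = log 2 N"
  have u: "2 powr (8 * real r * y\<^sup>2) * card V = u"
    unfolding u_def V by (simp add: powr_add)
  have "0 \<le> r * y ^ 3" "1 \<le> r * y\<^sup>2"
    using assms(4,5) mult_mono[of 1 "real r" 1 "y\<^sup>2"] by simp_all
  then have "2 powr 2 \<le> u"
    unfolding u_def by (intro powr_mono) auto
  then have "4 \<le> u"
    by simp
  have N: "real N \<le> u" "u - 1 < real N"
    unfolding N_def u using \<open>4 \<le> u\<close> by linarith+
  then have "2 < real N"
    using \<open>4 \<le> u\<close> by simp
  then have N_powr: "real N = 2 powr l"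
    unfolding l_def by simp
  \<comment> \<open>Rounding down loses less than 1, hence at most half of \<open>u\<close>, which
    costs at most 1 in the logarithm.\<close>
  have "2 powr (r * y ^ 3 + 8 * real r * y\<^sup>2 - 1) \<le> 2 powr l"
    using N \<open>4 \<le> u\<close> unfolding N_powr[symmetric] powr_diff u_def[symmetric] by simp
  then have l1: "r * y ^ 3 + 8 * real r * y\<^sup>2 - 1 \<le> l"
    by simp
  have "2 powr l \<le> 2 powr (r * y ^ 3 + 8 * real r * y\<^sup>2)"
    using N unfolding N_powr u_def by simp
  then have l2: "l \<le> r * y ^ 3 + 8 * real r * y\<^sup>2"
    by simp
  obtain p t :: nat where pt:
    "1 + real (p + r) * l \<le> real t * (l - r * y ^ 3 - 2)"
    "real r * l < real p * (l - r * y ^ 3 - 2 * real t - 1)"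
    using parameters_exist[OF assms(4,5) l1 l2] .
  have pow: "(2 powr a) ^ k = 2 powr (real k * a)" for a :: real and k
    by (simp add: powr_power)
  have "ramsey_property N V E"
  proof (rule ramsey_property_degenerate_bipartite[OF H, where p = p and t = t])
    show "0 < card V"
      using V by (intro gr0I) simp
    show "2 \<le> N"
      using \<open>2 < real N\<close> by simp
    have four: "4 = 2 powr (2::real)"
      by simp
    have "2 * (real N ^ (p + r) * real (card V) ^ t)
        = 2 powr (1 + (real (p + r) * l + real t * (r * y ^ 3)))"
      unfolding N_powr V pow powr_add by simp
    also have "\<dots> \<le> 2 powr (real t * (l - 2))"
      using pt(1) by (simp add: algebra_simps)
    also have "\<dots> = (real N / 4) ^ t"
      unfolding N_powr four powr_diff[symmetric] pow ..
    finally show "2 * (real N ^ (p + r) * real (card V) ^ t) \<le> (real N / 4) ^ t"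
      by simp
    have "real N ^ r * real (card V) ^ p = 2 powr (real r * l + real p * (r * y ^ 3))"
      unfolding N_powr V pow powr_add ..
    also have "\<dots> < 2 powr (real p * (l - (1 + real t * 2)))"
      using pt(2) by (simp add: algebra_simps)
    also have "\<dots> = (2 powr l / (2 powr 1 * (2 powr 2) ^ t)) ^ p"
      unfolding pow powr_add[symmetric] powr_diff[symmetric] ..
    finally show "real N ^ r * real (card V) ^ p < (real N / (2 * 4 ^ t)) ^ p"
      unfolding N_powr by simp
  qed
  then show ?thesis
    unfolding N_def .
qed

theorem theorem7p4:
  fixes r :: nat
  assumes "r \<ge> 1"
  shows "\<exists>n0::nat. \<forall>n\<ge>n0. \<forall>(V::'a set) E.
           simple_graph V E \<and> card V = n \<and> bipartite V E \<and> degenerate r V E \<longrightarrow>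
           real (ramsey_number V E)
             \<le> 2 powr (8 * real r powr (1/3) * (log 2 (real n)) powr (2/3)) * real n"
proof (intro exI[of _ "2 ^ (64 * r)"] allI impI)
  fix n :: nat and V :: "'a set" and E
  assume n: "2 ^ (64 * r) \<le> n"
    and H: "simple_graph V E \<and> card V = n \<and> bipartite V E \<and> degenerate r V E"
  define L where "L = log 2 (real n)"
  \<comment> \<open>The threshold \<open>2 ^ (64 * r)\<close> for \<open>n\<close> means
    \<open>64 \<le> L / r\<close>, which is \<open>4 \<le> y\<close>.\<close>
  define y where "y = (L / r) powr (1/3)"
  have "(1::nat) \<le> 2 ^ (64 * r)"
    by simp
  then have "0 < n"
    using n by linarith
  have "real (64 * r) \<le> L"
    unfolding L_def using n \<open>0 < n\<close> by (intro le_log_of_power) auto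
  then have "64 \<le> L / r"
    using assms by (simp add: field_simps)
  have "0 < L"
    using \<open>real (64 * r) \<le> L\<close> assms by simp
  have "4 = (64::real) powr (1/3)"
    using powr_powr[of "4::real" 3 "1/3"] by simp
  also have "\<dots> \<le> y"
    unfolding y_def using \<open>64 \<le> L / r\<close> by (intro powr_mono2) auto
  finally have "4 \<le> y" .
  have "y ^ 3 = L / r"
    unfolding y_def using \<open>0 < L\<close> assms by (subst powr_power) auto
  then have L: "L = r * y ^ 3"
    using assms by simp
  have y2: "y\<^sup>2 = L powr (2/3) / r powr (2/3)"
    unfolding y_def using \<open>0 < L\<close> assms by (subst powr_power) (auto simp: powr_divide)
  \<comment> \<open>The second factor cancels the denominator of \<open>y\<^sup>2\<close> and leaves
    the exponent 1/3 on \<open>r\<close>.\<close>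
  have "real r = r powr (1/3) * r powr (2/3)"
    using assms by (simp flip: powr_add)
  then have exponent: "8 * real r * y\<^sup>2 = 8 * real r powr (1/3) * L powr (2/3)"
    unfolding y2 using assms by (simp add: field_simps)
  define u where "u = 2 powr (8 * real r * y\<^sup>2) * card V"
  have V: "real (card V) = 2 powr (r * y ^ 3)"
    unfolding L[symmetric] L_def using H \<open>0 < n\<close> by simp
  have "ramsey_property (nat \<lfloor>u\<rfloor>) V E"
    unfolding u_def using H assms \<open>4 \<le> y\<close> V by (intro ramsey_property_powr) auto
  \<comment> \<open>The minimum in \<open>ramsey_number\<close> ranges over positive numbers, so the
    floor of \<open>u\<close> must be positive.\<close>
  moreover have "1 \<le> u"
  proof -
    have "1 * 1 \<le> u"
      unfolding u_def using H \<open>0 < n\<close> by (intro mult_mono ge_one_powr_ge_zero) auto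
    then show ?thesis by simp
  qed
  ultimately have "ramsey_number V E \<le> nat \<lfloor>u\<rfloor>"
    unfolding ramsey_number_def by (intro Least_le) (simp add: le_floor_iff)
  then have "real (ramsey_number V E) \<le> u"
    using \<open>1 \<le> u\<close> by linarith
  then show "real (ramsey_number V E)
      \<le> 2 powr (8 * real r powr (1/3) * (log 2 (real n)) powr (2/3)) * real n"
    unfolding u_def exponent using H by (simp add: L_def)
qed

end
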